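(* Let $G$ be an $n$-vertex directed graph with transversal number $\tau$. There is a word of length $O(\tau^2 n)$ that fixes every $n$-component monotone network with an interaction graph isomorphic to a subgraph of $G$.
   Context: The constant implied in $O(\cdot)$ is absolute (independent of $n$, $\tau$ and $G$). Graphs are directed and may contain loops. The transversal number of a directed graph is the minimum number of vertices to delete to make it acyclic (a loop is a cycle of length one). Write $[n]=\{1,\dots,n\}$. An $n$-component (Boolean) network is a function $f=(f_1,\dots,f_n):\{0,1\}^n\to\{0,1\}^n$. The interaction graph of $f$ is the directed graph on $[n]$ with an edge from $j$ to $i$ iff $f_i$ depends on $x_j$, i.e. there exist $x,y\in\{0,1\}^n$ differing only in component $j$ with $f_i(x)\ne f_i(y)$. For $i\in[n]$ and $x\in\{0,1\}^n$, $f^i(x):=(x_1,\dots,x_{i-1},f_i(x),x_{i+1},\dots,x_n)$. For a word $w=i_1i_2\dots i_k$ over the alphabet $[n]$, $f^w:=f^{i_k}\circ\cdots\circ f^{i_1}$ (and $f^\epsilon=\mathrm{id}$ for the empty word $\epsilon$). A word $w$ over $[n]$ fixes $f$ if $f^w(x)$ is a fixed point of $f$ for every $x\in\{0,1\}^n$. The network $f$ is monotone if $x\le y$ (componentwise) implies $f(x)\le f(y)$.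
   Formalization: The bound is O(max(1,τ)² n), since 0 letters fail when τ = 0; and the word is over the vertices of G, its letters being translated to [n] by the isomorphism from the subgraph to the interaction graph, since one untranslated word cannot serve all relabellings (it fails for τ = 1). *)

theory Defs
  imports
    "HOL-Library.FuncSet"
    "Graph_Theory.Pair_Digraph"
    "Graph_Theory.Digraph_Component"
    "Graph_Theory.Digraph_Isomorphism"
begin

(* The library's cycle counts a loop as a cycle of length one. *)
definition acyclic_digraph :: "('a, 'b) pre_digraph \<Rightarrow> bool" where
  "acyclic_digraph G \<longleftrightarrow> \<not> (\<exists>p. pre_digraph.cycle G p)"

definition transversal_number :: "('a, 'b) pre_digraph \<Rightarrow> nat" where
  "transversal_number G =
     (LEAST k. \<exists>X \<subseteq> verts G. card X = k \<and> acyclic_digraph (G \<restriction> (verts G - X)))"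

(* Configurations are undefined outside {1..n}, so equality of configurations, and
   the pointwise order on functions, are determined by the components 1, ..., n. *)
definition states :: "nat \<Rightarrow> (nat \<Rightarrow> bool) set" where
  "states n = ({1..n} \<rightarrow>\<^sub>E UNIV)"

type_synonym network = "(nat \<Rightarrow> bool) \<Rightarrow> (nat \<Rightarrow> bool)"

definition networks :: "nat \<Rightarrow> network set" where
  "networks n = (states n \<rightarrow> states n)"

definition interaction_graph :: "nat \<Rightarrow> network \<Rightarrow> nat pair_pre_digraph" where
  "interaction_graph n f =
     \<lparr> pverts = {1..n},
       parcs = {(j, i). j \<in> {1..n} \<and> i \<in> {1..n} \<and>
         (\<exists>x \<in> states n. \<exists>y \<in> states n.
            x j \<noteq> y j \<and> (\<forall>k \<in> {1..n} - {j}. x k = y k) \<and> f x i \<noteq> f y i)} \<rparr>"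

definition update :: "network \<Rightarrow> nat \<Rightarrow> (nat \<Rightarrow> bool) \<Rightarrow> (nat \<Rightarrow> bool)" where
  "update f i x = x(i := f x i)"

(* The letters of the word are applied from left to right. *)
definition word_action :: "network \<Rightarrow> nat list \<Rightarrow> (nat \<Rightarrow> bool) \<Rightarrow> (nat \<Rightarrow> bool)" where
  "word_action f w = fold (update f) w"

definition fixing_word :: "nat \<Rightarrow> network \<Rightarrow> nat list \<Rightarrow> bool" where
  "fixing_word n f w \<longleftrightarrow>
     set w \<subseteq> {1..n} \<and> (\<forall>x \<in> states n. f (word_action f w x) = word_action f w x)"

definition monotone_network :: "nat \<Rightarrow> network \<Rightarrow> bool" where
  "monotone_network n f \<longleftrightarrow> mono_on (states n) f"

(* An isomorphism h from a subgraph H of G onto the interaction graph of f.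
   As h identifies vertices of G with components of f, a word over the vertices of G
   acts on f after its letters are translated by h. *)
definition embeds_via ::
  "nat \<Rightarrow> network \<Rightarrow> (nat, nat \<times> nat) pre_digraph \<Rightarrow> (nat, nat \<times> nat) pre_digraph \<Rightarrow>
   (nat, nat \<times> nat, nat, nat \<times> nat) digraph_isomorphism \<Rightarrow> bool" where
  "embeds_via n f G H h \<longleftrightarrow>
     subgraph H G \<and> pre_digraph.digraph_isomorphism H h \<and>
     app_iso h H = with_proj (interaction_graph n f)"

end

theory Submission
  imports Defs
begin

text \<open>
  Remove a minimum transversal \<open>x\<^sub>1, \<dots>, x\<^sub>\<tau>\<close>. Updating the remaining vertices once in a topological
  order (a sweep) makes all of them stable. The transversal vertices are then taken in one at a
  time. When the vertices treated so far are stable and the next vertex \<open>x\<close> is updated, say to the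
  value \<open>b\<close>, monotonicity implies that from then on updates can change values only to \<open>b\<close>.
  In this regime each round, a sweep followed by an update of the transversal vertices treated so
  far, either starts its second part in a stable configuration or flips a transversal vertex for
  good. So after \<open>t\<close> rounds and a last sweep everything is stable, where \<open>t\<close> is the number of
  transversal vertices treated. This costs \<open>O(\<tau> n)\<close> letters per transversal vertex.
\<close>

section \<open>Topological orders of digraphs\<close>

text \<open>Put a minimal element first and recurse. Restricted to \<open>A\<close>, the relation is
  finite and acyclic, hence well-founded, so such an element exists.\<close>

lemma acyclic_topological_list:
  assumes "finite A" "acyclic r"
  shows "\<exists>vs. set vs = A \<and> distinct vs \<and> sorted_wrt (\<lambda>u v. (v, u) \<notin> r) vs"
  using assms(1)
proof (induction "card A" arbitrary: A)
  case 0
  then show ?case by (intro exI[of _ "[]"]) auto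
next
  case (Suc k)
  let ?s = "r \<inter> A \<times> A"
  have "acyclic ?s" using assms(2) by (rule acyclic_subset) blast
  moreover have "finite ?s" using Suc.prems by auto
  ultimately have "wf ?s" by (rule finite_acyclic_wf[rotated])
  moreover obtain a where "a \<in> A" using Suc.hyps(2) by fastforce
  ultimately obtain m where m: "m \<in> A" "\<And>y. (y, m) \<in> ?s \<Longrightarrow> y \<notin> A"
    by (rule wfE_min) blast
  have "k = card (A - {m})" using Suc.hyps(2) Suc.prems m(1) by simp
  from Suc.hyps(1)[OF this] obtain vs
    where vs: "set vs = A - {m}" "distinct vs" "sorted_wrt (\<lambda>u v. (v, u) \<notin> r) vs"
    using Suc.prems by auto
  have "\<forall>v \<in> set vs. (v, m) \<notin> r" using vs(1) m by blast
  moreover have "set (m # vs) = A" using vs(1) m(1) by auto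
  ultimately show ?case
    using vs by (intro exI[of _ "m # vs"]) simp
qed

lemma transversal_number_witness:
  obtains X where "X \<subseteq> verts G" "card X = transversal_number G"
    "acyclic_digraph (G \<restriction> (verts G - X))"
proof -
  \<comment> \<open>Deleting all vertices leaves no walk, so the minimum is taken over a nonempty
    set.\<close>
  have "acyclic_digraph (G \<restriction> (verts G - verts G))"
    by (auto simp: acyclic_digraph_def pre_digraph.cycle_def pre_digraph.awalk_def)
  then have "\<exists>k. \<exists>X \<subseteq> verts G. card X = k \<and> acyclic_digraph (G \<restriction> (verts G - X))"
    by blast
  from LeastI_ex[OF this] show ?thesis
    unfolding transversal_number_def[symmetric] using that by blast
qed

text \<open>A nonempty closed walk contains a cycle.\<close>

lemma (in wf_digraph) acyclic_arcs_ends: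
  assumes "acyclic_digraph G"
  shows "acyclic (arcs_ends G)"
proof (rule acyclicI, rule allI, rule notI)
  fix u assume "u \<rightarrow>\<^sup>+ u"
  then obtain p where "awalk u p u" "p \<noteq> []" by (auto simp: reachable1_awalk)
  then have "closed_w p" by (auto simp: closed_w_def)
  then show False using closed_w_imp_cycle assms by (auto simp: acyclic_digraph_def)
qed

lemma arcs_ends_induce_with_proj:
  "arcs_ends (with_proj G \<restriction> A) = parcs G \<inter> A \<times> A"
  by (auto simp: arcs_ends_conv image_iff)

section \<open>Embeddings of interaction graphs\<close>

text \<open>\<open>H\<close> has as many vertices as the interaction graph, namely n, so it spans
  \<open>G\<close> and every letter over \<open>pverts G\<close> is translated into a
  component.\<close>

lemma embeds_via_verts:
  assumes "embeds_via n f (with_proj G) H h" "finite (pverts G)" "card (pverts G) = n"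
  shows "iso_verts h ` pverts G = {1..n}" "inj_on (iso_verts h) (pverts G)"
proof -
  have sub: "verts H \<subseteq> pverts G" and inj: "inj_on (iso_verts h) (verts H)"
    and app: "app_iso h H = with_proj (interaction_graph n f)"
    using assms(1)
    by (auto simp: embeds_via_def subgraph_def pre_digraph.digraph_isomorphism_def)
  have im: "iso_verts h ` verts H = {1..n}"
    using arg_cong[OF app, of verts] by (simp add: interaction_graph_def)
  then have "card (verts H) = n" using card_image[OF inj] by simp
  then have "verts H = pverts G" using sub assms(2,3) by (intro card_subset_eq) auto
  then show "iso_verts h ` pverts G = {1..n}" "inj_on (iso_verts h) (pverts G)"
    using im inj by auto
qed

text \<open>With injectivity of \<open>iso_verts h\<close>, this carries non-arcs of
  \<open>G\<close> to non-arcs of the interaction graph, so a topological order survives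
  relabelling.\<close>

lemma embeds_via_arcs:
  assumes "embeds_via n f (with_proj G) H h" "(j, i) \<in> parcs (interaction_graph n f)"
  shows "\<exists>(u, v) \<in> parcs G. u \<in> pverts G \<and> v \<in> pverts G \<and> j = iso_verts h u \<and> i = iso_verts h v"
proof -
  have sub: "verts H \<subseteq> pverts G" "arcs H \<subseteq> parcs G" "tail H = fst" "head H = snd"
    and wf: "wf_digraph H" and iso: "pre_digraph.digraph_isomorphism H h"
    and app: "app_iso h H = with_proj (interaction_graph n f)"
    using assms(1) by (auto simp: embeds_via_def subgraph_def compatible_def)
  have "(j, i) \<in> iso_arcs h ` arcs H"
    using arg_cong[OF app, of arcs] assms(2) by simp
  then obtain e where e: "e \<in> arcs H" "iso_arcs h e = (j, i)" by auto
  have "iso_verts h (fst e) = j" "iso_verts h (snd e) = i"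
    using pre_digraph.iso_verts_tail[OF iso e(1)] pre_digraph.iso_verts_head[OF iso e(1)]
      arg_cong[OF app, of tail] arg_cong[OF app, of head] sub e(2) by simp_all
  moreover have "fst e \<in> pverts G" "snd e \<in> pverts G"
    using wf_digraph.wellformed[OF wf e(1)] sub by auto
  ultimately show ?thesis using e(1) sub(2) by (intro bexI[of _ e]) auto
qed

section \<open>The word\<close>

definition rounds :: "nat list \<Rightarrow> nat list \<Rightarrow> nat \<Rightarrow> nat list" where
  "rounds vs xs k = concat (replicate k (vs @ xs)) @ vs"

primrec sweep_word :: "nat list \<Rightarrow> nat list \<Rightarrow> nat list" where
  "sweep_word vs [] = vs"
| "sweep_word vs (x # xs) = sweep_word vs xs @ x # rounds vs (x # xs) (length (x # xs))"

lemma rounds_0: "rounds vs xs 0 = vs"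
  and rounds_Suc: "rounds vs xs (Suc k) = vs @ xs @ rounds vs xs k"
  by (simp_all add: rounds_def)

lemma set_rounds: "set (rounds vs xs k) \<subseteq> set vs \<union> set xs"
  by (induction k) (auto simp: rounds_0 rounds_Suc)

lemma length_rounds: "length (rounds vs xs k) = k * (length vs + length xs) + length vs"
  by (induction k) (auto simp: rounds_0 rounds_Suc)

lemma set_sweep_word: "set (sweep_word vs xs) \<subseteq> set vs \<union> set xs"
proof (induction xs)
  case (Cons x xs)
  then show ?case using set_rounds[of vs "x # xs" "length (x # xs)"] by auto
qed simp

text \<open>With V the length of \<open>vs\<close>, taking in the t-th vertex costs at most
  (t+1)(V+t) letters, while the square grows by 2t+1 \<ge> t+1.\<close>

lemma length_sweep_word:
  "length (sweep_word vs xs) \<le> (Suc (length xs))\<^sup>2 * (length vs + length xs)"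
  by (induction xs) (auto simp: length_rounds power2_eq_square algebra_simps)

lemma map_rounds: "map h (rounds vs xs k) = rounds (map h vs) (map h xs) k"
  by (induction k) (auto simp: rounds_0 rounds_Suc)

text \<open>Hence a single word chosen for \<open>G\<close> can be analysed, under each embedding,
  as the word built from the relabelled lists.\<close>

lemma map_sweep_word: "map h (sweep_word vs xs) = sweep_word (map h vs) (map h xs)"
  by (induction xs) (auto simp: map_rounds)

section \<open>Dynamics of monotone networks\<close>

lemma word_action_Nil [simp]: "word_action f [] x = x"
  and word_action_Cons [simp]: "word_action f (i # w) x = word_action f w (update f i x)"
  and word_action_append [simp]: "word_action f (u @ w) x = word_action f w (word_action f u x)"
  by (simp_all add: word_action_def)

definition stable_on :: "network \<Rightarrow> nat set \<Rightarrow> (nat \<Rightarrow> bool) \<Rightarrow> bool" where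
  "stable_on f P x \<longleftrightarrow> (\<forall>i \<in> P. f x i = x i)"

text \<open>In a configuration drifting to \<open>b\<close>, updates in \<open>P\<close> can only change values to \<open>b\<close>. Treating
  both values of \<open>b\<close> at once avoids a separate dual argument.\<close>

definition drifting :: "network \<Rightarrow> bool \<Rightarrow> nat set \<Rightarrow> (nat \<Rightarrow> bool) \<Rightarrow> bool" where
  "drifting f b P x \<longleftrightarrow> (\<forall>i \<in> P. x i = b \<longrightarrow> f x i = b)"

lemma word_action_stable_on:
  "stable_on f P x \<Longrightarrow> set w \<subseteq> P \<Longrightarrow> word_action f w x = x"
  by (induction w) (auto simp: stable_on_def update_def)

locale monotone_boolean_network =
  fixes n :: nat and f :: network
  assumes network: "f \<in> networks n" and monotone: "monotone_network n f"
begin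

lemma update_states: "x \<in> states n \<Longrightarrow> i \<in> {1..n} \<Longrightarrow> update f i x \<in> states n"
  by (auto simp: states_def update_def PiE_iff extensional_def)

lemma word_action_states: "x \<in> states n \<Longrightarrow> set w \<subseteq> {1..n} \<Longrightarrow> word_action f w x \<in> states n"
  by (induction w arbitrary: x) (auto simp: update_states simp del: atLeastAtMost_iff)

text \<open>Enlarging the set of components with value \<open>b\<close> means going up if
  \<open>b\<close> is true and down if it is false.\<close>

lemma mono_value:
  assumes "x \<in> states n" "y \<in> states n" "\<And>i. x i = b \<Longrightarrow> y i = b" "f x i = b"
  shows "f y i = b"
proof (cases b)
  case True
  then have "x \<le> y" using assms(3) by (auto simp: le_fun_def)
  then have "f x \<le> f y"
    using monotone assms(1,2) by (auto simp: monotone_network_def mono_on_def)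
  then show ?thesis using True assms(4) by (auto simp: le_fun_def)
next
  case False
  then have "y \<le> x" using assms(3) by (auto simp: le_fun_def)
  then have "f y \<le> f x"
    using monotone assms(1,2) by (auto simp: monotone_network_def mono_on_def)
  then show ?thesis using False assms(4) by (auto simp: le_fun_def)
qed

text \<open>If the update changes \<open>x\<close>, the two states differ in \<open>v\<close> alone,
  so a change of \<open>f\<close> at \<open>i\<close> would witness an arc from \<open>v\<close> to
  \<open>i\<close>.\<close>

lemma independent_update:
  assumes "x \<in> states n" "v \<in> {1..n}" "i \<in> {1..n}" "(v, i) \<notin> parcs (interaction_graph n f)"
  shows "f (update f v x) i = f x i"
proof (cases "f x v = x v")
  case True
  then show ?thesis by (simp add: update_def fun_upd_idem)
next
  case False
  define y where "y = update f v x"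
  have "y v \<noteq> x v" "\<forall>k \<in> {1..n} - {v}. y k = x k" "y \<in> states n"
    using False update_states[OF assms(1,2)] by (simp_all add: y_def update_def)
  moreover have "\<not> (\<exists>y \<in> states n. \<exists>x \<in> states n.
      y v \<noteq> x v \<and> (\<forall>k \<in> {1..n} - {v}. y k = x k) \<and> f y i \<noteq> f x i)"
    using assms(2-4) by (simp add: interaction_graph_def del: atLeastAtMost_iff)
  ultimately have "f y i = f x i" using assms(1) by blast
  then show ?thesis by (simp add: y_def)
qed

text \<open>The last vertex has no arc to itself or to earlier ones, so its update alters no target
  value in the list: earlier vertices stay stable and it becomes stable.\<close>

lemma sweep_stable_on:
  assumes "x \<in> states n" "set vs \<subseteq> {1..n}" "distinct vs"
    "sorted_wrt (\<lambda>u v. (v, u) \<notin> parcs (interaction_graph n f)) vs"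
    "\<forall>v \<in> set vs. (v, v) \<notin> parcs (interaction_graph n f)"
  shows "stable_on f (set vs) (word_action f vs x)"
  using assms
proof (induction vs rule: rev_induct)
  case Nil
  then show ?case by (simp add: stable_on_def)
next
  case (snoc v vs)
  define y where "y = word_action f vs x"
  have y: "y \<in> states n" using snoc.prems word_action_states by (auto simp: y_def)
  have st: "stable_on f (set vs) y"
    using snoc by (auto simp: y_def sorted_wrt_append)
  have "f (update f v y) i = f y i" if "i \<in> set (vs @ [v])" for i
    using that snoc.prems y by (intro independent_update) (auto simp: sorted_wrt_append)
  moreover have "update f v y i = f y i" if "i \<in> set (vs @ [v])" for i
    using that st by (auto simp: stable_on_def update_def)
  ultimately show ?case by (simp add: stable_on_def flip: y_def)
qed

text \<open>Drifting keeps a component that already has value \<open>b\<close>, so the set of such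
  components can only grow; monotonicity then keeps every target \<open>b\<close>.\<close>

lemma drifting_update:
  assumes "x \<in> states n" "P \<subseteq> {1..n}" "drifting f b P x" "j \<in> P"
  shows "drifting f b P (update f j x)" "x i = b \<Longrightarrow> update f j x i = b"
proof -
  show up: "update f j x i = b" if "x i = b" for i
    using that assms(3,4) by (auto simp: drifting_def update_def)
  have "f (update f j x) i = b" if "f x i = b" for i
    using mono_value[of x "update f j x" b i] that assms up update_states by auto
  then show "drifting f b P (update f j x)"
    using assms(3) by (auto simp: drifting_def update_def)
qed

lemma drifting_word_action:
  assumes "x \<in> states n" "P \<subseteq> {1..n}" "drifting f b P x" "set w \<subseteq> P"
  shows "drifting f b P (word_action f w x)" "x i = b \<Longrightarrow> word_action f w x i = b"
proof -
  have "drifting f b P (word_action f w x) \<and> (\<forall>i. x i = b \<longrightarrow> word_action f w x i = b)"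
    using assms
  proof (induction w arbitrary: x)
    case (Cons j w)
    then have "update f j x \<in> states n" using update_states by auto
    then show ?case
      using Cons drifting_update[of x P b j] by auto
  qed simp
  then show "drifting f b P (word_action f w x)" "x i = b \<Longrightarrow> word_action f w x i = b"
    by auto
qed

text \<open>The target \<open>b\<close> of \<open>i\<close> persists until an occurrence of
  \<open>i\<close> in \<open>w\<close>; that update sets \<open>i\<close> to \<open>b\<close>, and
  later letters cannot undo it.\<close>

lemma drifting_flip:
  assumes "x \<in> states n" "P \<subseteq> {1..n}" "drifting f b P x" "set w \<subseteq> P" "i \<in> set w" "f x i = b"
  shows "word_action f w x i = b"
proof -
  obtain u u' where w: "w = u @ i # u'" using assms(5) by (auto simp: in_set_conv_decomp)
  define y where "y = word_action f u x"
  have y: "y \<in> states n" "drifting f b P y" and "\<And>i. x i = b \<Longrightarrow> y i = b"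
    using assms w drifting_word_action[of x P b u] word_action_states[of x u]
    by (auto simp: y_def)
  then have "f y i = b" using mono_value[of x y b i] assms(1,6) by auto
  then have "update f i y i = b" by (simp add: update_def)
  moreover have "update f i y \<in> states n" "drifting f b P (update f i y)"
    using y assms w update_states drifting_update[of y P b i] by auto
  ultimately show ?thesis
    using drifting_word_action(2)[of "update f i y" P b u' i] assms(2,4) w by (simp add: y_def)
qed

text \<open>The potential is the number of vertices of \<open>xs\<close> not yet at
  \<open>b\<close>. Each round either meets a stable configuration or lowers it.\<close>

lemma rounds_stable_on:
  fixes vs xs :: "nat list"
  defines "P \<equiv> set vs \<union> set xs"
  assumes "x \<in> states n" "P \<subseteq> {1..n}" "drifting f b P x"
    and sweep: "\<And>y. y \<in> states n \<Longrightarrow> stable_on f (set vs) (word_action f vs y)"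
    and "card {i \<in> set xs. x i \<noteq> b} \<le> k"
  shows "stable_on f P (word_action f (rounds vs xs k) x)"
  using assms(2-4,6)
proof (induction k arbitrary: x)
  case 0
  define y where "y = word_action f vs x"
  have y: "drifting f b P y" "\<And>i. x i = b \<Longrightarrow> y i = b"
    using 0 drifting_word_action[of x P b vs] by (auto simp: y_def P_def)
  \<comment> \<open>At potential zero, drifting alone makes \<open>xs\<close> stable, and the final
    sweep handles \<open>vs\<close>.\<close>
  have "\<forall>i \<in> set xs. x i = b" using 0 by auto
  then have "\<forall>i \<in> set xs. f y i = y i" using y by (auto simp: drifting_def P_def)
  then show ?case
    using sweep[OF 0(1)] by (auto simp: rounds_0 stable_on_def P_def y_def)
next
  case (Suc k)
  define y where "y = word_action f vs x"
  have sub: "set vs \<subseteq> P" "set xs \<subseteq> P" by (auto simp: P_def)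
  have y: "y \<in> states n" "drifting f b P y" "\<And>i. x i = b \<Longrightarrow> y i = b"
    using Suc.prems sub drifting_word_action[of x P b vs] word_action_states[of x vs]
    by (auto simp: y_def)
  have act: "word_action f (rounds vs xs (Suc k)) x = word_action f (xs @ rounds vs xs k) y"
    by (simp add: rounds_Suc y_def)
  show ?case
  proof (cases "stable_on f P y")
    case True
    then show ?thesis
      unfolding act using set_rounds[of vs xs k] word_action_stable_on[OF True]
      by (auto simp: P_def)
  next
    case False
    \<comment> \<open>The sweep has just stabilised \<open>vs\<close>, so the instability lies in
      \<open>xs\<close>; drifting forces its direction to be towards \<open>b\<close>.\<close>
    then obtain i where i: "i \<in> set xs" "f y i \<noteq> y i"
      using sweep[OF Suc.prems(1)] by (auto simp: stable_on_def P_def y_def)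
    then have flip: "y i \<noteq> b" "f y i = b" using y(2) by (auto simp: drifting_def P_def)
    define z where "z = word_action f xs y"
    have z: "z \<in> states n" "drifting f b P z" "\<And>i. y i = b \<Longrightarrow> z i = b"
      using Suc.prems y sub drifting_word_action[of y P b xs] word_action_states[of y xs]
      by (auto simp: z_def)
    have "z i = b"
      using drifting_flip[of y P b xs i] y Suc.prems sub i flip by (simp add: z_def)
    then have "{i \<in> set xs. z i \<noteq> b} \<subset> {i \<in> set xs. x i \<noteq> b}"
      using flip i y(3) z(3) by blast
    then have "card {i \<in> set xs. z i \<noteq> b} < card {i \<in> set xs. x i \<noteq> b}"
      by (intro psubset_card_mono) auto
    then have "card {i \<in> set xs. z i \<noteq> b} \<le> k" using Suc.prems(4) by simp
    then show ?thesis
      unfolding act using Suc.IH[OF z(1) Suc.prems(2) z(2)] by (simp add: z_def)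
  qed
qed

lemma sweep_word_stable_on:
  assumes "x \<in> states n" "set vs \<union> set xs \<subseteq> {1..n}"
    and sweep: "\<And>y. y \<in> states n \<Longrightarrow> stable_on f (set vs) (word_action f vs y)"
  shows "stable_on f (set vs \<union> set xs) (word_action f (sweep_word vs xs) x)"
  using assms(2)
proof (induction xs)
  case Nil
  then show ?case using sweep assms(1) by simp
next
  case (Cons a xs)
  define y where "y = word_action f (sweep_word vs xs) x"
  define b where "b = f y a"
  let ?P = "set vs \<union> set (a # xs)"
  have st: "stable_on f (set vs \<union> set xs) y" using Cons by (simp add: y_def)
  have y: "y \<in> states n"
    using Cons.prems set_sweep_word[of vs xs] assms(1) word_action_states[of x "sweep_word vs xs"]
    by (auto simp: y_def)
  \<comment> \<open>Stable vertices keep their value, whatever \<open>b\<close> is, and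
    \<open>a\<close> has target \<open>b\<close> by the choice of \<open>b\<close>.\<close>
  have "drifting f b ?P y"
    using st by (auto simp: drifting_def stable_on_def b_def)
  then have "drifting f b ?P (update f a y)"
    using y Cons.prems by (intro drifting_update) auto
  moreover have "update f a y \<in> states n" using y Cons.prems by (intro update_states) auto
  moreover have "card {i \<in> set (a # xs). update f a y i \<noteq> b} \<le> length (a # xs)"
    by (rule order_trans[OF card_mono card_length]) auto
  ultimately have "stable_on f ?P (word_action f (rounds vs (a # xs) (length (a # xs))) (update f a y))"
    using rounds_stable_on Cons.prems sweep by blast
  then show ?case by (simp add: y_def)
qed

lemma fixing_sweep_word:
  assumes "set vs \<union> set xs = {1..n}" "distinct vs"
    "sorted_wrt (\<lambda>u v. (v, u) \<notin> parcs (interaction_graph n f)) vs"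
    "\<forall>v \<in> set vs. (v, v) \<notin> parcs (interaction_graph n f)"
  shows "fixing_word n f (sweep_word vs xs)"
proof -
  have sub: "set (sweep_word vs xs) \<subseteq> {1..n}" using set_sweep_word assms(1) by metis
  have "f y = y" if "x \<in> states n" "y = word_action f (sweep_word vs xs) x" for x y
  proof -
    have "y \<in> states n" using word_action_states[OF that(1) sub] that(2) by simp
    moreover from this have "f y \<in> states n" using network by (auto simp: networks_def)
    moreover have "stable_on f {1..n} y"
      unfolding that(2) assms(1)[symmetric]
      using assms by (intro sweep_word_stable_on[OF that(1)] sweep_stable_on) auto
    \<comment> \<open>Stability compares components in \<open>{1..n}\<close>; elsewhere both states
      are undefined.\<close>
    ultimately show "f y = y"
      unfolding states_def stable_on_def by (intro PiE_ext) auto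
  qed
  then show ?thesis using sub by (auto simp: fixing_word_def)
qed

end

section \<open>Transfer to embedded networks and the final bound\<close>

lemma sweep_word_fixes_embedded:
  assumes "set vs \<union> set xs = pverts G" "distinct vs" "finite (pverts G)" "card (pverts G) = n"
    "sorted_wrt (\<lambda>u v. (v, u) \<notin> parcs G) vs" "\<forall>v \<in> set vs. (v, v) \<notin> parcs G"
    "f \<in> networks n" "monotone_network n f" "embeds_via n f (with_proj G) H h"
  shows "fixing_word n f (map (iso_verts h) (sweep_word vs xs))"
proof -
  interpret monotone_boolean_network n f using assms by unfold_locales
  note im = embeds_via_verts[OF assms(9,3,4)]
  have arc: "(v, u) \<in> parcs G"
    if "u \<in> set vs" "v \<in> set vs"
      "(iso_verts h v, iso_verts h u) \<in> parcs (interaction_graph n f)" for u v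
    using embeds_via_arcs[OF assms(9) that(3)] that(1,2) assms(1) inj_onD[OF im(2)] by blast
  show ?thesis
    unfolding map_sweep_word
  proof (rule fixing_sweep_word)
    show "set (map (iso_verts h) vs) \<union> set (map (iso_verts h) xs) = {1..n}"
      using im(1) assms(1) by (auto simp flip: image_Un)
    show "distinct (map (iso_verts h) vs)"
      using assms(1,2) im(2) by (auto simp: distinct_map intro: inj_on_subset)
    show "sorted_wrt (\<lambda>u v. (v, u) \<notin> parcs (interaction_graph n f)) (map (iso_verts h) vs)"
      unfolding sorted_wrt_map using assms(5) by (rule sorted_wrt_mono_rel[rotated]) (use arc in blast)
    show "\<forall>v \<in> set (map (iso_verts h) vs). (v, v) \<notin> parcs (interaction_graph n f)"
      using arc assms(6) by auto
  qed
qed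

theorem theorem5:
  shows "\<exists>C :: nat. \<forall>(n :: nat) (\<tau> :: nat) (G :: nat pair_pre_digraph).
    pair_fin_digraph G \<and> card (pverts G) = n \<and> transversal_number (with_proj G) = \<tau> \<longrightarrow>
    (\<exists>w :: nat list. set w \<subseteq> pverts G \<and> length w \<le> C * (max 1 \<tau>)\<^sup>2 * n \<and>
      (\<forall>f \<in> networks n. monotone_network n f \<longrightarrow>
        (\<forall>H h. embeds_via n f (with_proj G) H h \<longrightarrow> fixing_word n f (map (iso_verts h) w))))"
proof (rule exI[of _ 4], intro allI impI, elim conjE)
  fix n \<tau> :: nat and G :: "nat pair_pre_digraph"
  assume G: "pair_fin_digraph G" and n: "card (pverts G) = n"
    and \<tau>: "transversal_number (with_proj G) = \<tau>"
  interpret pair_fin_digraph G by (fact G)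
  obtain X where X: "X \<subseteq> pverts G" "card X = \<tau>"
    "acyclic_digraph (with_proj G \<restriction> (pverts G - X))"
    using transversal_number_witness[of "with_proj G"] \<tau> by auto
  define A where "A = pverts G - X"
  have "finite X" "finite A" using X(1) pair_finite_verts by (auto simp: A_def finite_subset)
  have acyc: "acyclic (parcs G \<inter> A \<times> A)"
    using wf_digraph.acyclic_arcs_ends[OF wellformed_induce_subgraph X(3)]
    unfolding arcs_ends_induce_with_proj by (simp add: A_def)
  obtain vs where vs: "set vs = A" "distinct vs" "sorted_wrt (\<lambda>u v. (v, u) \<notin> parcs G \<inter> A \<times> A) vs"
    using acyclic_topological_list[OF \<open>finite A\<close> acyc] by blast
  obtain xs where xs: "set xs = X" "distinct xs"
    using finite_distinct_list[OF \<open>finite X\<close>] by blast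
  have "sorted_wrt (\<lambda>u v. (v, u) \<notin> parcs G) vs"
    using vs(3) by (rule sorted_wrt_mono_rel[rotated]) (use vs(1) in auto)
  moreover have "\<forall>v \<in> set vs. (v, v) \<notin> parcs G"
    using acyc vs(1) by (auto simp: acyclic_def)
  moreover have all: "set vs \<union> set xs = pverts G" using vs xs X(1) by (auto simp: A_def)
  ultimately have fixes_all: "fixing_word n f (map (iso_verts h) (sweep_word vs xs))"
    if "f \<in> networks n" "monotone_network n f" "embeds_via n f (with_proj G) H h" for f H h
    using that vs(2) n pair_finite_verts by (intro sweep_word_fixes_embedded) auto
  have "length xs = \<tau>" using xs X(2) distinct_card by metis
  moreover have "length vs + length xs = n"
  proof -
    have "length vs = card A" "length xs = card X" using vs xs distinct_card by metis+
    then show ?thesis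
      using n X(1) pair_finite_verts \<open>finite X\<close> card_mono[of "pverts G" X]
      by (simp add: A_def card_Diff_subset)
  qed
  ultimately have "length (sweep_word vs xs) \<le> (Suc \<tau>)\<^sup>2 * n"
    using length_sweep_word[of vs xs] by simp
  \<comment> \<open>The constant 4 comes from \<tau> + 1 \<le> 2 max(1, \<tau>); the maximum covers
    \<tau> = 0, where the word is a single sweep.\<close>
  also have "(Suc \<tau>)\<^sup>2 \<le> (2 * max 1 \<tau>)\<^sup>2" by (rule power_mono) auto
  then have "(Suc \<tau>)\<^sup>2 * n \<le> 4 * (max 1 \<tau>)\<^sup>2 * n" by (simp add: power_mult_distrib)
  finally have "length (sweep_word vs xs) \<le> 4 * (max 1 \<tau>)\<^sup>2 * n" .
  moreover have "set (sweep_word vs xs) \<subseteq> pverts G" using set_sweep_word all by metis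
  ultimately show "\<exists>w. set w \<subseteq> pverts G \<and> length w \<le> 4 * (max 1 \<tau>)\<^sup>2 * n \<and>
      (\<forall>f \<in> networks n. monotone_network n f \<longrightarrow>
        (\<forall>H h. embeds_via n f (with_proj G) H h \<longrightarrow> fixing_word n f (map (iso_verts h) w)))"
    using fixes_all by blast
qed

end
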